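(* Every QoS satisfaction game with $N$ players has the finite improvement property. Moreover, any asynchronous better response update process is guaranteed to reach a pure Nash equilibrium with no more than $4N+3N^2$ asynchronous better response updates, irrespective of the initial strategy profile and of the order in which the players update.
   Context: A QoS satisfaction game is a tuple $(\mathcal{N},\mathcal{C},(Q_n^c)_{n\in\mathcal{N},c\in\mathcal{C}},(D_n)_{n\in\mathcal{N}})$ where $\mathcal{N}=\{1,\ldots,N\}$ is the set of players (users), $\mathcal{C}=\{1,\ldots,C\}$ is the set of channels, each $Q_n^c$ is a non-increasing real-valued function of the congestion level (the data rate), and $D_n\ge 0$ is the demand of player $n$. Each player's strategy set is $\tilde{\mathcal{C}}=\{0,1,\ldots,C\}$, where $0$ is the dormant state. A strategy profile is $\boldsymbol{x}=(x_1,\ldots,x_N)\in\tilde{\mathcal{C}}^N$. The congestion level of channel $c$ is $I^c(\boldsymbol{x})=|\{n\in\mathcal{N}:x_n=c\}|$. The utility of player $n$ is $U_n(\boldsymbol{x})=1$ if $x_n\ne 0$ and $Q_n^{x_n}(I^{x_n}(\boldsymbol{x}))\ge D_n$; $U_n(\boldsymbol{x})=0$ if $x_n=0$; and $U_n(\boldsymbol{x})=-1$ if $x_n\neq 0$ and $Q_n^{x_n}(I^{x_n}(\boldsymbol{x}))<D_n$. Equivalent interference threshold form: $(\mathcal{N},\mathcal{C},(T_n^c)_{n\in\mathcal{N},c\in\mathcal{C}})$ with integer thresholds $T_n^c\in\{0,1,\ldots,N+1\}$ satisfying $Q_n^c(I)\ge D_n \Leftrightarrow I\le T_n^c$ for $I\in\{1,\ldots,N\}$.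 In this form, $U_n(\boldsymbol{x})=1$ if $x_n\ne0$ and $I^{x_n}(\boldsymbol{x})\le T_n^{x_n}$, $U_n(\boldsymbol{x})=0$ if $x_n=0$, and $U_n(\boldsymbol{x})=-1$ if $x_n\neq0$ and $I^{x_n}(\boldsymbol{x})>T_n^{x_n}$. A better response update is a change by a single player $n$ of its strategy from $x_n$ to $c\in\tilde{\mathcal{C}}$, all other strategies being unchanged, such that $U_n$ strictly increases. A strategy profile is a pure Nash equilibrium if no player can perform a better response update. An asynchronous better response update process is a sequence of strategy profiles in which each profile is obtained from the previous one by a better response update of exactly one player (and which continues as long as some better response update is possible). A game has the finite improvement property if any asynchronous better response update process terminates at a pure Nash equilibrium within a finite number of updates. *)

theory Defs
  imports Complex_Main "HOL-Library.FuncSet" "HOL-Library.Extended_Nat"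
begin

text \<open>Quality-of-service satisfaction games. \<open>rate G n c I\<close> is the data rate
  $Q_n^c(I)$ of player \<open>n\<close> on channel \<open>c\<close> at congestion level \<open>I\<close>, and \<open>demand G n\<close>
  is $D_n$.\<close>

record qos_game =
  num_players :: nat
  num_channels :: nat
  rate :: "nat \<Rightarrow> nat \<Rightarrow> nat \<Rightarrow> real"
  demand :: "nat \<Rightarrow> real"

definition players :: "qos_game \<Rightarrow> nat set" where
  "players G = {1..num_players G}"

definition channels :: "qos_game \<Rightarrow> nat set" where
  "channels G = {1..num_channels G}"

text \<open>Strategy \<open>0\<close> is the dormant state.\<close>

definition strategies :: "qos_game \<Rightarrow> nat set" where
  "strategies G = {0..num_channels G}"

text \<open>A player on a channel sees a congestion level between \<open>1\<close> and the number of
  players, so the rates only matter, and are only constrained, on that range.\<close>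

definition is_qos_game :: "qos_game \<Rightarrow> bool" where
  "is_qos_game G \<longleftrightarrow>
     (\<forall>n\<in>players G. \<forall>c\<in>channels G. antimono_on {1..num_players G} (rate G n c)) \<and>
     (\<forall>n\<in>players G. demand G n \<ge> 0)"

definition profiles :: "qos_game \<Rightarrow> (nat \<Rightarrow> nat) set" where
  "profiles G = players G \<rightarrow>\<^sub>E strategies G"

definition congestion :: "qos_game \<Rightarrow> (nat \<Rightarrow> nat) \<Rightarrow> nat \<Rightarrow> nat" where
  "congestion G x c = card {n \<in> players G. x n = c}"

definition utility :: "qos_game \<Rightarrow> nat \<Rightarrow> (nat \<Rightarrow> nat) \<Rightarrow> int" where
  "utility G n x =
     (if x n = 0 then 0
      else if rate G n (x n) (congestion G x (x n)) \<ge> demand G n then 1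
      else -1)"

definition better_response_update ::
  "qos_game \<Rightarrow> nat \<Rightarrow> (nat \<Rightarrow> nat) \<Rightarrow> (nat \<Rightarrow> nat) \<Rightarrow> bool" where
  "better_response_update G n x y \<longleftrightarrow>
     (\<exists>c\<in>strategies G. y = x(n := c)) \<and> utility G n x < utility G n y"

definition pure_Nash_equilibrium :: "qos_game \<Rightarrow> (nat \<Rightarrow> nat) \<Rightarrow> bool" where
  "pure_Nash_equilibrium G x \<longleftrightarrow>
     x \<in> profiles G \<and> \<not> (\<exists>n\<in>players G. \<exists>y. better_response_update G n x y)"

text \<open>A process performs \<open>L\<close> updates, possibly infinitely many, and passes through the
  profiles \<open>X t\<close> with \<open>t \<le> L\<close>; values of \<open>X\<close> beyond \<open>L\<close> are irrelevant. It may only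
  stop, that is, \<open>L\<close> may only be finite, when no better response update is possible.\<close>

definition better_response_process ::
  "qos_game \<Rightarrow> enat \<Rightarrow> (nat \<Rightarrow> nat \<Rightarrow> nat) \<Rightarrow> bool" where
  "better_response_process G L X \<longleftrightarrow>
     X 0 \<in> profiles G \<and>
     (\<forall>t. enat t < L \<longrightarrow> (\<exists>n\<in>players G. better_response_update G n (X t) (X (Suc t)))) \<and>
     (\<forall>t. L = enat t \<longrightarrow> \<not> (\<exists>n\<in>players G. \<exists>y. better_response_update G n (X t) y))"

definition finite_improvement_property :: "qos_game \<Rightarrow> bool" where
  "finite_improvement_property G \<longleftrightarrow>
     (\<forall>L X. better_response_process G L X \<longrightarrow>
        (\<exists>k. L = enat k \<and> pure_Nash_equilibrium G (X k)))"

end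

theory Submission
  imports Defs
begin

text \<open>Let \<open>T\<close> be the interference thresholds. The integer
  $\sum_{n : x_n \neq 0} (2 T_n^{x_n} + 1) - \sum_c I^c (I^c + 1)$ is a generalized ordinal
  potential: if a dormant player \<open>n\<close> enters a channel \<open>c\<close> and thereby raises its congestion
  level to \<open>I\<close>, it changes by $2 T_n^c + 1 - 2 I$, an odd number whose sign is the utility that
  \<open>n\<close> obtains on \<open>c\<close>. Splitting an arbitrary move into leaving to the dormant state and
  entering the new channel, one sees that each better response raises the potential by at least
  one. The potential lies between $-N(N+1)$ and $N(2N+1)$.\<close>

definition threshold :: "qos_game \<Rightarrow> nat \<Rightarrow> nat \<Rightarrow> nat" where
  "threshold G n c = card {I \<in> {1..num_players G}. rate G n c I \<ge> demand G n}"

definition potential :: "qos_game \<Rightarrow> (nat \<Rightarrow> nat) \<Rightarrow> int" where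
  "potential G x =
     (\<Sum>n\<in>players G. if x n = 0 then 0 else 2 * int (threshold G n (x n)) + 1) -
     (\<Sum>c\<in>channels G. int (congestion G x c) * (int (congestion G x c) + 1))"

text \<open>In a profile, this is what the presence of \<open>n\<close> on its channel adds to the
  potential, relative to \<open>n\<close> being dormant.\<close>

definition gain :: "qos_game \<Rightarrow> nat \<Rightarrow> (nat \<Rightarrow> nat) \<Rightarrow> int" where
  "gain G n x =
     (if x n = 0 then 0 else 2 * int (threshold G n (x n)) + 1 - 2 * int (congestion G x (x n)))"

lemma finite_players [simp]: "finite (players G)"
  and finite_channels [simp]: "finite (channels G)"
  and card_players: "card (players G) = num_players G"
  by (simp_all add: players_def channels_def)

lemma threshold_le: "threshold G n c \<le> num_players G"
  unfolding threshold_def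
  by (rule order_trans[OF card_mono[of "{1..num_players G}"]]) auto

text \<open>Rates are antitone, so the acceptable levels form an initial segment of
  \<open>{1..num_players G}\<close>; counting them therefore yields the largest one, or 0 if there
  is none.\<close>

lemma demand_le_rate_iff_le_threshold:
  assumes "is_qos_game G" "n \<in> players G" "c \<in> channels G" "I \<in> {1..num_players G}"
  shows "demand G n \<le> rate G n c I \<longleftrightarrow> I \<le> threshold G n c"
proof -
  have anti: "rate G n c J \<le> rate G n c I"
    if "I \<in> {1..num_players G}" "J \<in> {1..num_players G}" "I \<le> J" for I J
    using assms(1-3) that unfolding is_qos_game_def monotone_on_def by blast
  let ?S = "{I \<in> {1..num_players G}. demand G n \<le> rate G n c I}"
  show ?thesis
  proof
    assume "demand G n \<le> rate G n c I"
    then have "{1..I} \<subseteq> ?S"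
      using anti[of _ I] assms(4) by fastforce
    then have "card {1..I} \<le> card ?S"
      by (intro card_mono) auto
    then show "I \<le> threshold G n c"
      by (simp add: threshold_def)
  next
    assume le: "I \<le> threshold G n c"
    show "demand G n \<le> rate G n c I"
    proof (rule ccontr)
      assume not: "\<not> demand G n \<le> rate G n c I"
      have "?S \<subseteq> {1..<I}"
      proof
        fix J assume J: "J \<in> ?S"
        then have "\<not> I \<le> J"
          using anti[of I J] assms(4) not by auto
        then show "J \<in> {1..<I}" using J by auto
      qed
      then have "card ?S \<le> card {1..<I}"
        by (intro card_mono) auto
      \<comment> \<open>As \<open>I\<close> is at least 1, \<open>card {1..<I}\<close> is
        \<open>I - 1\<close>, strictly below \<open>I\<close>.\<close>
      then show False
        using le assms(4) unfolding threshold_def by simp linarith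
    qed
  qed
qed

lemma congestion_le: "congestion G x c \<le> num_players G"
proof -
  have "congestion G x c \<le> card (players G)"
    unfolding congestion_def by (intro card_mono) auto
  then show ?thesis by (simp add: card_players)
qed

text \<open>The lower bound holds because \<open>n\<close> counts itself. This places the level in
  the range where rates are antitone.\<close>

lemma congestion_in_range:
  assumes "n \<in> players G"
  shows "congestion G x (x n) \<in> {1..num_players G}"
proof -
  have "congestion G x (x n) > 0"
    using assms by (auto simp: congestion_def card_gt_0_iff)
  then show ?thesis using congestion_le[of G x "x n"] by simp
qed

lemma profile_dormant_or_channel:
  assumes "x \<in> profiles G" "n \<in> players G"
  shows "x n = 0 \<or> x n \<in> channels G"
proof -
  have "x n \<in> strategies G"
    using assms unfolding profiles_def by (auto dest: PiE_mem)
  then show ?thesis by (auto simp: strategies_def channels_def)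
qed

lemma utility_eq_sgn_gain:
  assumes "is_qos_game G" "x \<in> profiles G" "n \<in> players G"
  shows "utility G n x = sgn (gain G n x)"
proof (cases "x n = 0")
  case False
  then have "x n \<in> channels G"
    using profile_dormant_or_channel[OF assms(2,3)] by simp
  from demand_le_rate_iff_le_threshold[OF assms(1,3) this congestion_in_range[of n G x, OF assms(3)]]
  have "demand G n \<le> rate G n (x n) (congestion G x (x n)) \<longleftrightarrow>
      congestion G x (x n) \<le> threshold G n (x n)" .
  \<comment> \<open>By parity the gain on a channel is never 0; a level equal to the threshold gives
    gain 1, matching utility 1.\<close>
  moreover have "2 * int (threshold G n (x n)) + 1 \<noteq> 2 * int (congestion G x (x n))"
    by presburger
  ultimately show ?thesis using False by (auto simp: utility_def gain_def sgn_if)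
qed (simp add: utility_def gain_def)

text \<open>The case \<open>d = 0\<close> is excluded because the number of dormant players may
  grow; \<open>potential\<close> sums over channels only.\<close>

lemma congestion_upd_other:
  assumes "d \<noteq> 0" "d \<noteq> x n"
  shows "congestion G (x(n := 0)) d = congestion G x d"
  unfolding congestion_def using assms by (intro arg_cong[of _ _ card]) auto

lemma congestion_upd_same:
  assumes "n \<in> players G" "x n \<noteq> 0"
  shows "congestion G x (x n) = Suc (congestion G (x(n := 0)) (x n))"
proof -
  have "{m \<in> players G. x m = x n} = insert n {m \<in> players G. (x(n := 0)) m = x n}"
    using assms by auto
  then show ?thesis using assms by (simp add: congestion_def)
qed

text \<open>Sending \<open>n\<close> to the dormant state alters at most one summand of each sum:
  that of \<open>n\<close> and that of channel \<open>x n\<close>.\<close>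

lemma potential_dormant:
  assumes "x \<in> profiles G" "n \<in> players G"
  shows "potential G x = potential G (x(n := 0)) + gain G n x"
proof (cases "x n = 0")
  case True
  then have "x(n := 0) = x" by auto
  then show ?thesis using True by (simp add: gain_def)
next
  case False
  then have ch: "x n \<in> channels G"
    using profile_dormant_or_channel[OF assms] by simp
  let ?f = "\<lambda>x m. if x m = 0 then 0 else 2 * int (threshold G m (x m)) + 1"
  let ?g = "\<lambda>x c. int (congestion G x c) * (int (congestion G x c) + 1)"
  have "sum (?f x) (players G - {n}) = sum (?f (x(n := 0))) (players G - {n})"
    by (intro sum.cong) auto
  then have f: "sum (?f x) (players G) = ?f x n + sum (?f (x(n := 0))) (players G)"
    using assms(2) by (simp add: sum.remove[of _ n])
  have "sum (?g x) (channels G - {x n}) = sum (?g (x(n := 0))) (channels G - {x n})"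
    by (intro sum.cong) (auto simp: congestion_upd_other channels_def)
  \<comment> \<open>With \<open>I\<close> the level of \<open>x n\<close> in \<open>x\<close>, the
    summand falls from \<open>I * (I + 1)\<close> to \<open>(I - 1) * I\<close>, a drop of
    \<open>2 * I\<close>.\<close>
  then have g: "sum (?g x) (channels G) =
      sum (?g (x(n := 0))) (channels G) + 2 * int (congestion G x (x n))"
    using ch congestion_upd_same[of n G x, OF assms(2) False]
    by (simp add: sum.remove[of _ "x n"] algebra_simps)
  show ?thesis
    using f g False by (simp add: potential_def gain_def)
qed

lemma better_response_profile:
  assumes "x \<in> profiles G" "n \<in> players G" "better_response_update G n x y"
  shows "y \<in> profiles G"
proof -
  obtain c where "c \<in> strategies G" "y = x(n := c)"
    using assms(3) unfolding better_response_update_def by blast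
  then show ?thesis
    using assms(1,2) fun_upd_in_PiE[of n "players G" x "\<lambda>_. strategies G"]
    by (auto simp: profiles_def PiE_iff extensional_def)
qed

text \<open>Both profiles become the same one once \<open>n\<close> is dormant, so their potentials
  differ exactly as the gains do; a smaller sign forces a smaller gain.\<close>

lemma potential_increases:
  assumes "is_qos_game G" "x \<in> profiles G" "n \<in> players G" "better_response_update G n x y"
  shows "potential G x < potential G y"
proof -
  have y: "y \<in> profiles G"
    using better_response_profile assms by blast
  have "sgn (gain G n x) < sgn (gain G n y)"
    using assms y utility_eq_sgn_gain unfolding better_response_update_def by metis
  then have "gain G n x < gain G n y"
    by (auto simp: sgn_if split: if_splits)
  moreover have "x(n := 0) = y(n := 0)"
    using assms(4) unfolding better_response_update_def by auto
  ultimately show ?thesis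
    using potential_dormant[OF assms(2,3)] potential_dormant[OF y assms(3)] by simp
qed

text \<open>Distinct channels have disjoint sets of users; dormant players are missing from the
  count, hence only an inequality.\<close>

lemma sum_congestion_le: "(\<Sum>c\<in>channels G. congestion G x c) \<le> num_players G"
proof -
  have "(\<Sum>c\<in>channels G. congestion G x c) =
      card (\<Union>c\<in>channels G. {n \<in> players G. x n = c})"
    unfolding congestion_def by (rule card_UN_disjoint[symmetric]) auto
  also have "\<dots> \<le> card (players G)"
    by (intro card_mono) auto
  finally show ?thesis by (simp add: card_players)
qed

lemma potential_upper:
  "potential G x \<le> int (num_players G) * (2 * int (num_players G) + 1)"
proof -
  have "(\<Sum>n\<in>players G. if x n = 0 then 0 else 2 * int (threshold G n (x n)) + 1)
      \<le> (\<Sum>n\<in>players G. 2 * int (num_players G) + 1)"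
    using threshold_le by (intro sum_mono) auto
  moreover have "0 \<le> (\<Sum>c\<in>channels G. int (congestion G x c) * (int (congestion G x c) + 1))"
    by (intro sum_nonneg) auto
  ultimately show ?thesis by (simp add: potential_def card_players)
qed

lemma potential_lower:
  "- (int (num_players G) * (int (num_players G) + 1)) \<le> potential G x"
proof -
  let ?N = "int (num_players G)"
  \<comment> \<open>Only the second factor is bounded by \<open>?N + 1\<close>; the first is kept
    and summed, so the bound is free of the number of channels.\<close>
  have "(\<Sum>c\<in>channels G. int (congestion G x c) * (int (congestion G x c) + 1))
      \<le> (\<Sum>c\<in>channels G. int (congestion G x c) * (?N + 1))"
    using congestion_le by (intro sum_mono mult_left_mono) auto
  also have "\<dots> = int (\<Sum>c\<in>channels G. congestion G x c) * (?N + 1)"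
    by (simp add: sum_distrib_right)
  also have "\<dots> \<le> ?N * (?N + 1)"
    using sum_congestion_le[of G x] by (intro mult_right_mono) linarith+
  finally have "(\<Sum>c\<in>channels G. int (congestion G x c) * (int (congestion G x c) + 1))
      \<le> ?N * (?N + 1)" .
  moreover have
    "0 \<le> (\<Sum>n\<in>players G. if x n = 0 then 0 else 2 * int (threshold G n (x n)) + 1)"
    by (intro sum_nonneg) auto
  ultimately show ?thesis by (simp add: potential_def)
qed

text \<open>The potential is an integer, so each strict increase is at least 1. Finite and infinite
  processes are treated alike.\<close>

lemma process_invariant:
  assumes "is_qos_game G" "better_response_process G L X" "enat t \<le> L"
  shows "X t \<in> profiles G \<and> potential G (X 0) + int t \<le> potential G (X t)"
  using assms(3)
proof (induction t)
  case 0
  then show ?case using assms(2) by (simp add: better_response_process_def)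
next
  case (Suc t)
  then have lt: "enat t < L" by (simp add: Suc_ile_eq)
  then obtain n where n: "n \<in> players G" "better_response_update G n (X t) (X (Suc t))"
    using assms(2) unfolding better_response_process_def by blast
  with Suc.IH lt show ?case
    using potential_increases[OF assms(1) _ n] better_response_profile[OF _ n] by force
qed

lemma process_length_le:
  assumes "is_qos_game G" "better_response_process G L X" "enat t \<le> L"
  shows "t \<le> 2 * num_players G + 3 * (num_players G)\<^sup>2"
proof -
  \<comment> \<open>The span of the potential is \<open>N * (2 * N + 1) + N * (N + 1)\<close>, that
    is \<open>2 * N + 3 * N^2\<close>, for \<open>N\<close> players.\<close>
  have "int t \<le> int (2 * num_players G + 3 * (num_players G)\<^sup>2)"
    using process_invariant[OF assms] potential_upper[of G "X t"] potential_lower[of G "X 0"]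
    by (simp add: power2_eq_square algebra_simps)
  then show ?thesis by (simp only: of_nat_le_iff)
qed

lemma process_terminates:
  assumes "is_qos_game G" "better_response_process G L X"
  shows "\<exists>k. L = enat k \<and> k \<le> 2 * num_players G + 3 * (num_players G)\<^sup>2 \<and>
    pure_Nash_equilibrium G (X k)"
proof (cases L)
  case (enat k)
  then have "\<not> (\<exists>n\<in>players G. \<exists>y. better_response_update G n (X k) y)"
    using assms(2) unfolding better_response_process_def by blast
  then show ?thesis
    using enat process_invariant[OF assms, of k] process_length_le[OF assms, of k]
    by (simp add: pure_Nash_equilibrium_def)
next
  case infinity
  then show ?thesis
    \<comment> \<open>An infinite process would perform one update more than the bound
      allows.\<close>
    using process_length_le[OF assms, of "Suc (2 * num_players G + 3 * (num_players G)\<^sup>2)"]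
    by simp
qed

theorem theorem1:
  fixes G :: qos_game and N :: nat
  assumes "is_qos_game G" and "num_players G = N"
  shows "finite_improvement_property G \<and>
    (\<forall>L X. better_response_process G L X \<longrightarrow>
       (\<exists>k. L = enat k \<and> k \<le> 4 * N + 3 * N\<^sup>2 \<and> pure_Nash_equilibrium G (X k)))"
  \<comment> \<open>The bound \<open>2 * N + 3 * N^2\<close> obtained above is at most the claimed
    one.\<close>
  using process_terminates[OF assms(1)] assms(2)
  unfolding finite_improvement_property_def by fastforce

end
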